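(* There exists a polynomial-time algorithm that, for any given $\epsilon\le 1$, satisfies: (1) given a $7$-regular graph $G=(V,E)$ (an instance of $\#\textsc{HC}(7,\tfrac23)$), it constructs a $7$-regular graph $G'=(V',E')$ with size polynomial in $|G|$ that is an instance of $\#\textsc{INDEP-SET-INC}(7,\tfrac{2}{19})$, i.e. $i_k(G')\le i_{\lfloor 2|V'|/19\rfloor}(G')$ for every $k<\lfloor 2|V'|/19\rfloor$; and (2) given a multiplicative $e^{\pm\epsilon/2}$-approximation to $i_{\lfloor 2|V'|/19\rfloor}(G')$, an $e^{\pm\epsilon}$-multiplicative approximation of $Z_G(\tfrac23)$ can be computed in polynomial time.
   Context: For a graph $G$, $i_k(G)$ denotes the number of independent sets of $G$ of size $k$. The hardcore partition function at fugacity $\lambda$ is $Z_G(\lambda)=\sum_I \lambda^{|I|}$, summing over all independent sets $I$ of $G$; the problem $\#\textsc{HC}(\Delta,\lambda)$ asks, given a $\Delta$-regular graph $G$, to compute $Z_G(\lambda)$. The problem $\#\textsc{INDEP-SET-INC}(7,\tfrac{2}{19})$ asks, given a $7$-regular graph $G=(V,E)$ with $i_k(G)\le i_{\lfloor 2|V|/19\rfloor}(G)$ for all $k<\lfloor 2|V|/19\rfloor$, to compute $i_{\lfloor 2|V|/19\rfloor}(G)$. *)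

theory Defs
  imports
    Complex_Main
    "HOL-Library.Log_Nat"
    "HOL-Computational_Algebra.Polynomial"
    "Graph_Theory.Pair_Digraph"
begin

section \<open>Counting independent sets\<close>

text \<open>Finite simple graphs are the symmetric loop-free pair digraphs of \<^locale>\<open>pair_graph\<close>;
  an edge is represented by its two orientations, so the out-degree is the usual degree.\<close>

definition regular_graph :: "nat \<Rightarrow> 'a pair_pre_digraph \<Rightarrow> bool" where
  "regular_graph d G \<longleftrightarrow> pair_graph G \<and> (\<forall>v\<in>pverts G. out_degree (with_proj G) v = d)"

definition indep_sets :: "'a pair_pre_digraph \<Rightarrow> 'a set set" where
  "indep_sets G = {I. I \<subseteq> pverts G \<and> (\<forall>u\<in>I. \<forall>v\<in>I. (u, v) \<notin> parcs G)}"

definition num_indep_sets :: "'a pair_pre_digraph \<Rightarrow> nat \<Rightarrow> nat" where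
  "num_indep_sets G k = card {I \<in> indep_sets G. card I = k}"

definition hardcore_Z :: "'a pair_pre_digraph \<Rightarrow> real \<Rightarrow> real" where
  "hardcore_Z G fug = (\<Sum>I\<in>indep_sets G. fug ^ card I)"

definition target_size :: "real \<Rightarrow> 'a pair_pre_digraph \<Rightarrow> nat" where
  "target_size \<alpha> G = nat \<lfloor>\<alpha> * real (card (pverts G))\<rfloor>"

definition indep_set_inc_instance :: "nat \<Rightarrow> real \<Rightarrow> 'a pair_pre_digraph \<Rightarrow> bool" where
  "indep_set_inc_instance d \<alpha> G \<longleftrightarrow>
     regular_graph d G \<and>
     (\<forall>k < target_size \<alpha> G. num_indep_sets G k \<le> num_indep_sets G (target_size \<alpha> G))"

definition mult_approx :: "real \<Rightarrow> real \<Rightarrow> real \<Rightarrow> bool" where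
  "mult_approx \<delta> x y \<longleftrightarrow> exp (- \<delta>) * y \<le> x \<and> x \<le> exp \<delta> * y"


section \<open>Random access machine with logarithmic cost\<close>

text \<open>
  Algorithms are programs of a deterministic random access machine, presented as a structured
  language. The memory consists of arrays of natural numbers; a program can only mention the
  finitely many arrays whose names occur literally in it, while indices into an array are computed
  (indirect addressing). Input is placed in array 0, preceded by its length, and all other cells
  are 0 initially. Output is an append-only list, so that producing it is paid for.

  Running time is measured by the logarithmic cost criterion: every operation costs one plus the
  lengths of the binary representations of all numbers involved, including addresses. Under this
  criterion polynomial time on the machine is polynomial time on Turing machines, also in the
  presence of multiplication and division as primitives.
\<close>

type_synonym memory = "nat \<Rightarrow> nat \<Rightarrow> nat"
type_synonym config = "memory \<times> nat list"

datatype expr =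
    Const nat
  | Cell nat expr
  | Add expr expr
  | Sub expr expr
  | Mul expr expr
  | Div expr expr

fun val :: "expr \<Rightarrow> memory \<Rightarrow> nat" where
  "val (Const n) m = n"
| "val (Cell a i) m = m a (val i m)"
| "val (Add e f) m = val e m + val f m"
| "val (Sub e f) m = val e m - val f m"
| "val (Mul e f) m = val e m * val f m"
| "val (Div e f) m = val e m div val f m"

text \<open>The length of an operand is already contained in the cost of the subexpression computing it.\<close>

fun expr_cost :: "expr \<Rightarrow> memory \<Rightarrow> nat" where
  "expr_cost (Const n) m = 1 + floorlog 2 n"
| "expr_cost (Cell a i) m = 1 + floorlog 2 (val (Cell a i) m) + expr_cost i m"
| "expr_cost (Add e f) m = 1 + floorlog 2 (val (Add e f) m) + expr_cost e m + expr_cost f m"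
| "expr_cost (Sub e f) m = 1 + floorlog 2 (val (Sub e f) m) + expr_cost e m + expr_cost f m"
| "expr_cost (Mul e f) m = 1 + floorlog 2 (val (Mul e f) m) + expr_cost e m + expr_cost f m"
| "expr_cost (Div e f) m = 1 + floorlog 2 (val (Div e f) m) + expr_cost e m + expr_cost f m"

datatype com =
    Skip
  | Store nat expr expr
  | Write expr
  | Seq com com
  | Cond expr com com
  | While expr com

text \<open>\<open>exec c s t s'\<close>: started in \<open>s\<close>, the program \<open>c\<close> halts in \<open>s'\<close> at total cost \<open>t\<close>.
  A test succeeds if its value is nonzero.\<close>

inductive exec :: "com \<Rightarrow> config \<Rightarrow> nat \<Rightarrow> config \<Rightarrow> bool" where
  Skip: "exec Skip s 1 s"
| Store: "exec (Store a i e) (m, out) (1 + expr_cost i m + expr_cost e m)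
            (m(a := (m a)(val i m := val e m)), out)"
| Write: "exec (Write e) (m, out) (1 + expr_cost e m) (m, out @ [val e m])"
| Seq: "exec c s t s' \<Longrightarrow> exec d s' u s'' \<Longrightarrow> exec (Seq c d) s (t + u) s''"
| CondTrue: "val e m \<noteq> 0 \<Longrightarrow> exec c (m, out) t s' \<Longrightarrow>
    exec (Cond e c d) (m, out) (1 + expr_cost e m + t) s'"
| CondFalse: "val e m = 0 \<Longrightarrow> exec d (m, out) t s' \<Longrightarrow>
    exec (Cond e c d) (m, out) (1 + expr_cost e m + t) s'"
| WhileFalse: "val e m = 0 \<Longrightarrow> exec (While e c) (m, out) (1 + expr_cost e m) (m, out)"
| WhileTrue: "val e m \<noteq> 0 \<Longrightarrow> exec c (m, out) t s' \<Longrightarrow> exec (While e c) s' u s'' \<Longrightarrow>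
    exec (While e c) (m, out) (1 + expr_cost e m + t + u) s''"

definition initial_memory :: "nat list \<Rightarrow> memory" where
  "initial_memory xs =
     (\<lambda>a i. if a = 0 \<and> i \<le> length xs then (length xs # xs) ! i else 0)"

definition outputs_within :: "com \<Rightarrow> nat list \<Rightarrow> nat list \<Rightarrow> nat \<Rightarrow> bool" where
  "outputs_within c xs ys T \<longleftrightarrow>
     (\<exists>t m. t \<le> T \<and> exec c (initial_memory xs, []) t (m, ys))"

definition input_size :: "nat list \<Rightarrow> nat" where
  "input_size xs = (\<Sum>x\<leftarrow>xs. 1 + floorlog 2 x)"

text \<open>A graph on the vertex set \<open>{..<n}\<close> is encoded by \<open>n\<close> followed by its adjacency matrix,
  row by row.\<close>

definition encode_graph :: "nat pair_pre_digraph \<Rightarrow> nat list" where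
  "encode_graph G = (let n = card (pverts G) in
     n # map (\<lambda>e. of_bool (e \<in> parcs G)) (List.product [0..<n] [0..<n]))"

text \<open>Sanity check: a program has at most one result and one running time on each input.\<close>

lemma exec_deterministic:
  "exec c s t s' \<Longrightarrow> exec c s u s'' \<Longrightarrow> u = t \<and> s'' = s'"
proof (induction arbitrary: u s'' rule: exec.induct)
  case (Seq c s t s' d t2 s2)
  from Seq.prems obtain t1' t2' r where
    "u = t1' + t2'" "exec c s t1' r" "exec d r t2' s''"
    by (cases rule: exec.cases) auto
  with Seq.IH show ?case by blast
next
  case (WhileTrue e m c out t s' t2 s2)
  from WhileTrue.prems WhileTrue.hyps(1) obtain t1' t2' r where
    "u = 1 + expr_cost e m + t1' + t2'" "exec c (m, out) t1' r" "exec (While e c) r t2' s''"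
    by (cases rule: exec.cases) auto
  with WhileTrue.IH show ?case by blast
next
  case (CondTrue e m c out t s' d)
  from CondTrue.prems CondTrue.hyps(1) obtain t' where
    "u = 1 + expr_cost e m + t'" "exec c (m, out) t' s''"
    by (cases rule: exec.cases) auto
  with CondTrue.IH show ?case by blast
next
  case (CondFalse e m d out t s' c)
  from CondFalse.prems CondFalse.hyps(1) obtain t' where
    "u = 1 + expr_cost e m + t'" "exec d (m, out) t' s''"
    by (cases rule: exec.cases) auto
  with CondFalse.IH show ?case by blast
next
  case (WhileFalse e m c out)
  from WhileFalse.prems WhileFalse.hyps show ?case
    by (cases rule: exec.cases) auto
next
  case (Skip s)
  then show ?case by (cases rule: exec.cases) auto
next
  case (Store a i e m out)
  then show ?case by (cases rule: exec.cases) auto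
next
  case (Write e m out)
  then show ?case by (cases rule: exec.cases) auto
qed

end

theory Submission
  imports Defs
begin

text \<open>Take \<open>G'\<close> to be \<open>G\<close> together with \<open>r\<close> disjoint copies of \<open>K\<^sub>8\<close>, so that
  \<open>i\<^sub>k(G') = \<Sum>\<^sub>j i\<^sub>j(G) c(k - j)\<close> with \<open>c(l) = 8\<^sup>l (r choose l)\<close>. The value \<open>2/19\<close> is the
  occupancy fraction of \<open>K\<^sub>8\<close> at fugacity \<open>2/3\<close>: near the target size \<open>t\<close> consecutive terms satisfy
  \<open>c(l - 1) / c(l) \<approx> 2/3\<close>, and for \<open>r\<close> of order \<open>n\<^sup>2 / \<epsilon>\<close> the errors accumulated over at most \<open>n\<close>
  steps amount to a factor \<open>e\<^sup>\<epsilon>\<^sup>/\<^sup>2\<close>. Hence \<open>i\<^sub>t(G') \<approx> c(t) Z\<^sub>G(2/3)\<close>, and dividing by \<open>c(t)\<close> recovers the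
  partition function. Since \<open>c\<close> increases up to \<open>8r/9\<close>, beyond \<open>t \<approx> 16r/19\<close>, the convolution is
  monotone up to \<open>t\<close> summand by summand.\<close>

section \<open>Adding disjoint cliques to a graph\<close>

definition add_clique :: "'a set \<Rightarrow> 'a pair_pre_digraph \<Rightarrow> 'a pair_pre_digraph" where
  "add_clique C G =
     \<lparr>pverts = pverts G \<union> C, parcs = parcs G \<union> {(u, v). u \<in> C \<and> v \<in> C \<and> u \<noteq> v}\<rparr>"

lemma regular_graph_arcsD:
  assumes "regular_graph d G" "(u, v) \<in> parcs G"
  shows "u \<in> pverts G" "v \<in> pverts G" "u \<noteq> v" "(v, u) \<in> parcs G"
proof -
  interpret pair_graph G using assms(1) by (simp add: regular_graph_def)
  show "u \<in> pverts G" "v \<in> pverts G" using assms(2) by (auto dest: in_arcsD1 in_arcsD2)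
  show "u \<noteq> v" using assms(2) by (rule no_loops')
  show "(v, u) \<in> parcs G" using assms(2) by (rule arcs_symmetric)
qed

lemma regular_graph_finite: "regular_graph d G \<Longrightarrow> finite (pverts G)"
  by (simp add: regular_graph_def pair_graph_def pair_digraph_def pair_fin_digraph_def
      pair_fin_digraph_axioms_def)

text \<open>No arc joins \<open>C\<close> to \<open>G\<close>, so all out-arcs of a vertex lie on
  its own side, and a clique on \<open>d + 1\<close> vertices is \<open>d\<close>-regular.\<close>

lemma regular_graph_add_clique:
  assumes G: "regular_graph d G" and C: "finite C" "C \<inter> pverts G = {}" "card C = Suc d"
  shows "regular_graph d (add_clique C G)"
proof -
  note arcsD = regular_graph_arcsD[OF G]
  have fin: "finite (pverts G)" using G by (rule regular_graph_finite)
  have "parcs (add_clique C G) \<subseteq> (pverts G \<union> C) \<times> (pverts G \<union> C)"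
    by (auto simp: add_clique_def dest: arcsD)
  then have "finite (parcs (add_clique C G))"
    by (rule finite_subset) (use fin C in auto)
  then have "pair_graph (add_clique C G)"
    by unfold_locales
      (auto simp: add_clique_def fin C symmetric_def sym_def dest: arcsD)
  moreover have "out_degree (with_proj (add_clique C G)) v = d" if "v \<in> pverts G \<union> C" for v
  proof (cases "v \<in> C")
    case True
    then have "out_arcs (with_proj (add_clique C G)) v = Pair v ` (C - {v})"
      using C by (auto simp: out_arcs_def add_clique_def dest: arcsD)
    then show ?thesis
      using C True by (simp add: out_degree_def card_image inj_on_def)
  next
    case False
    then have "out_arcs (with_proj (add_clique C G)) v = out_arcs (with_proj G) v"
      by (auto simp: out_arcs_def add_clique_def)
    then show ?thesis
      using False that G by (simp add: out_degree_def regular_graph_def)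
  qed
  ultimately show ?thesis
    by (simp add: regular_graph_def add_clique_def)
qed

section \<open>Independent sets after adding one clique\<close>

lemma finite_indep_sets: "finite (pverts G) \<Longrightarrow> finite (indep_sets G)"
  by (rule finite_subset[of _ "Pow (pverts G)"]) (auto simp: indep_sets_def)

lemma num_indep_sets_eq_0:
  assumes "finite (pverts G)" "card (pverts G) < k"
  shows "num_indep_sets G k = 0"
proof -
  have "card I \<noteq> k" if "I \<in> indep_sets G" for I
    using that assms card_mono[of "pverts G" I] by (auto simp: indep_sets_def)
  then have "{I \<in> indep_sets G. card I = k} = {}" by blast
  then show ?thesis unfolding num_indep_sets_def by (metis card.empty)
qed

lemma num_indep_sets_0: "num_indep_sets G 0 = 1" if "finite (pverts G)"
proof -
  have "{I \<in> indep_sets G. card I = 0} = {{}}"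
    using that by (auto simp: indep_sets_def dest: finite_subset)
  then show ?thesis by (simp add: num_indep_sets_def)
qed

lemma hardcore_Z_eq_sum:
  assumes "finite (pverts G)"
  shows "hardcore_Z G x = (\<Sum>k\<le>card (pverts G). real (num_indep_sets G k) * x ^ k)"
proof -
  have *: "card ` indep_sets G \<subseteq> {..card (pverts G)}"
    using assms by (auto simp: indep_sets_def intro: card_mono)
  have "hardcore_Z G x =
      (\<Sum>k\<le>card (pverts G). \<Sum>I\<in>{I \<in> indep_sets G. card I = k}. x ^ card I)"
    unfolding hardcore_Z_def
    by (rule sum.group[symmetric]) (use * finite_indep_sets[OF assms] in auto)
  also have "\<dots> = (\<Sum>k\<le>card (pverts G). real (num_indep_sets G k) * x ^ k)"
    by (intro sum.cong) (auto simp: num_indep_sets_def)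
  finally show ?thesis .
qed

text \<open>An independent set contains at most one vertex of a clique, and a vertex of
  \<open>C\<close> has no neighbour in \<open>G\<close>, so it can join any independent set of
  \<open>G\<close>.\<close>

lemma indep_sets_add_clique:
  assumes G: "regular_graph d G" and C: "C \<inter> pverts G = {}"
  shows "indep_sets (add_clique C G) =
    indep_sets G \<union> (\<lambda>(v, I). insert v I) ` (C \<times> indep_sets G)" (is "?L = ?R")
proof
  show "?L \<subseteq> ?R"
  proof
    fix I assume I: "I \<in> ?L"
    show "I \<in> ?R"
    proof (cases "I \<inter> C = {}")
      case True
      with I show ?thesis by (auto simp: indep_sets_def add_clique_def)
    next
      case False
      then obtain v where v: "v \<in> I" "v \<in> C" by blast
      have "I - {v} \<in> indep_sets G"
        using I v C by (auto simp: indep_sets_def add_clique_def)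
      moreover have "I = insert v (I - {v})" using v by blast
      ultimately show ?thesis using v by blast
    qed
  qed
  show "?R \<subseteq> ?L"
    using C by (auto simp: indep_sets_def add_clique_def dest: regular_graph_arcsD[OF G])
qed

text \<open>In generating functions: the added clique multiplies the independence polynomial by
  \<open>1 + card C * x\<close>. The two terms count the sets that avoid \<open>C\<close> and those
  that meet it.\<close>

lemma num_indep_sets_add_clique:
  assumes G: "regular_graph d G" and C: "finite C" "C \<inter> pverts G = {}"
  shows "num_indep_sets (add_clique C G) (Suc k) =
    num_indep_sets G (Suc k) + card C * num_indep_sets G k"
proof -
  let ?A = "{I \<in> indep_sets G. card I = Suc k}" and ?B = "{I \<in> indep_sets G. card I = k}"
  let ?ins = "\<lambda>(v, I). insert v I"
  have fin: "finite (pverts G)" using G by (rule regular_graph_finite)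
  have I: "finite I" "C \<inter> I = {}" if "I \<in> indep_sets G" for I
    using that C fin by (auto simp: indep_sets_def dest: finite_subset)
  \<comment> \<open>The inserted vertex is the only element of the resulting set in
    \<open>C\<close>, so the set determines the pair.\<close>
  have inj: "inj_on ?ins (C \<times> ?B)"
  proof (rule inj_onI, clarsimp)
    fix v I w J
    assume *: "v \<in> C" "w \<in> C" "I \<in> indep_sets G" "J \<in> indep_sets G" "insert v I = insert w J"
    have "v \<notin> I" "w \<notin> J" "w \<notin> I" "v \<notin> J" using * I(2) by blast+
    then show "v = w \<and> I = J" using *(5) by (metis insert_iff insert_ident)
  qed
  have "{I \<in> indep_sets (add_clique C G). card I = Suc k} = ?A \<union> ?ins ` (C \<times> ?B)"
  proof -
    have "card (insert v I) = Suc (card I)" if "v \<in> C" "I \<in> indep_sets G" for v I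
    proof -
      have "v \<notin> I" using I(2)[OF that(2)] that(1) by blast
      then show ?thesis using I(1)[OF that(2)] by simp
    qed
    then show ?thesis unfolding indep_sets_add_clique[OF G C(2)] by (auto simp: image_iff)
  qed
  moreover have "?A \<inter> ?ins ` (C \<times> ?B) = {}" using I(2) by fastforce
  moreover have "finite ?A" "finite ?B" using finite_indep_sets[OF fin] by auto
  ultimately show ?thesis
    using inj C(1) by (simp add: num_indep_sets_def card_Un_disjoint card_image card_cartesian_product)
qed

primrec add_cliques :: "nat \<Rightarrow> nat \<Rightarrow> nat pair_pre_digraph \<Rightarrow> nat pair_pre_digraph" where
  "add_cliques q 0 G = G"
| "add_cliques q (Suc r) G =
     add_clique {card (pverts G) + q * r..<card (pverts G) + q * Suc r} (add_cliques q r G)"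

lemma pverts_add_cliques:
  assumes "pverts G = {..<card (pverts G)}"
  shows "pverts (add_cliques q r G) = {..<card (pverts G) + q * r}"
  by (induction r) (use assms in \<open>auto simp: add_clique_def\<close>)

lemma regular_graph_add_cliques:
  assumes "regular_graph d G" "pverts G = {..<card (pverts G)}"
  shows "regular_graph d (add_cliques (Suc d) r G)"
proof (induction r)
  case (Suc r)
  show ?case
    unfolding add_cliques.simps
    by (rule regular_graph_add_clique[OF Suc]) (auto simp: pverts_add_cliques[OF assms(2)])
qed (simp add: assms)

text \<open>A description of the arcs without recursion, which the construction program can test for
  a single matrix entry.\<close>

lemma parcs_add_cliques:
  assumes "q > 0"
  shows "(u, v) \<in> parcs (add_cliques q r G) \<longleftrightarrow> (u, v) \<in> parcs G \<or>
     (let n = card (pverts G) in n \<le> u \<and> n \<le> v \<and> u < n + q * r \<and> v < n + q * r \<and> u \<noteq> v \<and>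
       (u - n) div q = (v - n) div q)"
proof (induction r)
  case 0
  then show ?case by (auto simp: Let_def)
next
  case (Suc r)
  let ?n = "card (pverts G)"
  have less: "w < ?n + q * s \<longleftrightarrow> w < ?n \<or> ?n \<le> w \<and> (w - ?n) div q < s" for w s
    using assms by (cases "w < ?n") (auto simp: div_less_iff_less_mult mult.commute)
  have block: "?n + q * r \<le> w \<and> w < ?n + q * Suc r \<longleftrightarrow> ?n \<le> w \<and> (w - ?n) div q = r" for w
    using less[of w r] less[of w "Suc r"] by (auto simp del: mult_Suc_right)
  have "(u, v) \<in> parcs (add_cliques q (Suc r) G) \<longleftrightarrow> (u, v) \<in> parcs (add_cliques q r G) \<or>
      (?n + q * r \<le> u \<and> u < ?n + q * Suc r) \<and> (?n + q * r \<le> v \<and> v < ?n + q * Suc r) \<and> u \<noteq> v"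
    by (auto simp: add_clique_def)
  also have "\<dots> \<longleftrightarrow> (u, v) \<in> parcs G \<or> (?n \<le> u \<and> ?n \<le> v \<and> u < ?n + q * Suc r \<and>
      v < ?n + q * Suc r \<and> u \<noteq> v \<and> (u - ?n) div q = (v - ?n) div q)"
    unfolding Suc.IH Let_def block unfolding less by auto
  finally show ?case by (simp add: Let_def)
qed

text \<open>The \<open>r\<close> cliques contribute the factor \<open>(1 + (d + 1) * x) ^ r\<close>
  to the independence polynomial; this compares coefficients.\<close>

lemma num_indep_sets_add_cliques:
  assumes "regular_graph d G" "pverts G = {..<card (pverts G)}"
  shows "num_indep_sets (add_cliques (Suc d) r G) k =
    (\<Sum>j\<le>k. num_indep_sets G j * ((r choose (k - j)) * Suc d ^ (k - j)))"
proof (induction r arbitrary: k)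
  case 0
  have "(\<Sum>j\<le>k. num_indep_sets G j * ((0 choose (k - j)) * Suc d ^ (k - j))) =
      (\<Sum>j\<in>{k}. num_indep_sets G j * ((0 choose (k - j)) * Suc d ^ (k - j)))"
    by (rule sum.mono_neutral_right) (auto simp: binomial_eq_0)
  then show ?case by simp
next
  case (Suc r)
  let ?c = "\<lambda>r l. (r choose l) * Suc d ^ l"
  have fin: "finite (pverts (add_cliques (Suc d) r' G))" for r'
    by (simp add: pverts_add_cliques[OF assms(2)])
  show ?case
  proof (cases k)
    case 0
    then show ?thesis 
      using num_indep_sets_0[OF fin, of "Suc r"] num_indep_sets_0[OF fin, of 0]
      by (simp del: add_cliques.simps(2))
  next
    case (Suc l)
    have "num_indep_sets (add_cliques (Suc d) (Suc r) G) (Suc l) =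
      num_indep_sets (add_cliques (Suc d) r G) (Suc l) +
      Suc d * num_indep_sets (add_cliques (Suc d) r G) l"
      unfolding add_cliques.simps
      by (subst num_indep_sets_add_clique[OF regular_graph_add_cliques[OF assms]])
        (auto simp: pverts_add_cliques[OF assms(2)])
    also have "\<dots> = num_indep_sets G (Suc l) +
        (\<Sum>j\<le>l. num_indep_sets G j * (?c r (Suc l - j) + Suc d * ?c r (l - j)))"
      unfolding Suc.IH
      by (simp add: sum.distrib sum_distrib_left algebra_simps del: power_Suc)
    \<comment> \<open>Pascal's rule. The term \<open>j = Suc l\<close> was split off because its
      coefficient is 1 for every number of cliques.\<close>
    also have "(\<Sum>j\<le>l. num_indep_sets G j * (?c r (Suc l - j) + Suc d * ?c r (l - j))) =
        (\<Sum>j\<le>l. num_indep_sets G j * ?c (Suc r) (Suc l - j))"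
      by (rule sum.cong) (auto simp: Suc_diff_le algebra_simps)
    finally show ?thesis unfolding Suc by simp
  qed
qed

section \<open>Running time bounds on the machine\<close>

primrec expr_nodes :: "expr \<Rightarrow> nat" where
  "expr_nodes (Const c) = 1"
| "expr_nodes (Cell a i) = 1 + expr_nodes i"
| "expr_nodes (Add e f) = 1 + expr_nodes e + expr_nodes f"
| "expr_nodes (Sub e f) = 1 + expr_nodes e + expr_nodes f"
| "expr_nodes (Mul e f) = 1 + expr_nodes e + expr_nodes f"
| "expr_nodes (Div e f) = 1 + expr_nodes e + expr_nodes f"

primrec max_const :: "expr \<Rightarrow> nat" where
  "max_const (Const c) = c"
| "max_const (Cell a i) = max_const i"
| "max_const (Add e f) = max (max_const e) (max_const f)"
| "max_const (Sub e f) = max (max_const e) (max_const f)"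
| "max_const (Mul e f) = max (max_const e) (max_const f)"
| "max_const (Div e f) = max (max_const e) (max_const f)"

definition cells_below :: "nat \<Rightarrow> memory \<Rightarrow> bool" where
  "cells_below b m \<longleftrightarrow> (\<forall>a i. m a i < b)"

lemma cells_below_upd:
  "cells_below b m \<Longrightarrow> x < b \<Longrightarrow> cells_below b (m(a := (m a)(i := x)))"
  by (simp add: cells_below_def)

text \<open>Under each operation the bit length is at most the sum of the lengths of the operands
  plus one, and the operator's own node provides \<open>w > 0\<close> further bits.\<close>

lemma val_less:
  assumes "cells_below (2 ^ w) m" "w > 0" "max_const e < 2 ^ w"
  shows "val e m < 2 ^ (expr_nodes e * w)"
  using assms(3)
proof (induction e)
  case (Cell a i)
  have "val (Cell a i) m < 2 ^ w" using assms(1) by (simp add: cells_below_def)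
  also have "(2::nat) ^ w \<le> 2 ^ (expr_nodes (Cell a i) * w)" by (intro power_increasing) auto
  finally show ?case .
next
  case (Add e f)
  let ?k = "expr_nodes e * w" and ?l = "expr_nodes f * w"
  have "val e m + val f m < 2 ^ ?k + 2 ^ ?l" using Add by (intro add_strict_mono) auto
  also have "(2::nat) ^ ?k + 2 ^ ?l \<le> 2 ^ (?k + ?l) + 2 ^ (?k + ?l)"
    by (intro add_mono power_increasing) auto
  also have "\<dots> = 2 ^ Suc (?k + ?l)" by simp
  also have "(2::nat) ^ Suc (?k + ?l) \<le> 2 ^ (expr_nodes (Add e f) * w)"
    using assms(2) by (intro power_increasing) (auto simp: algebra_simps)
  finally show ?case by simp
next
  case (Sub e f)
  have "val (Sub e f) m \<le> val e m" by simp
  also have "\<dots> < 2 ^ (expr_nodes e * w)" using Sub by simp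
  also have "(2::nat) ^ (expr_nodes e * w) \<le> 2 ^ (expr_nodes (Sub e f) * w)"
    by (intro power_increasing) (auto simp: algebra_simps)
  finally show ?case .
next
  case (Mul e f)
  have "val e m * val f m < 2 ^ (expr_nodes e * w) * 2 ^ (expr_nodes f * w)"
    using Mul by (intro mult_strict_mono) auto
  also have "\<dots> \<le> 2 ^ (expr_nodes (Mul e f) * w)"
    unfolding power_add[symmetric] by (intro power_increasing) (auto simp: algebra_simps)
  finally show ?case by simp
next
  case (Div e f)
  have "val (Div e f) m \<le> val e m" by simp
  also have "\<dots> < 2 ^ (expr_nodes e * w)" using Div by simp
  also have "(2::nat) ^ (expr_nodes e * w) \<le> 2 ^ (expr_nodes (Div e f) * w)"
    by (intro power_increasing) (auto simp: algebra_simps)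
  finally show ?case .
qed simp

text \<open>Every node costs one plus the length of its value, and all these lengths are within the
  bound for the whole expression.\<close>

lemma expr_cost_le_nodes:
  assumes "cells_below (2 ^ w) m" "w > 0" "max_const e < 2 ^ w"
  shows "expr_cost e m \<le> expr_nodes e * (1 + expr_nodes e * w)"
proof -
  have log: "floorlog 2 (val e m) \<le> expr_nodes e * w" if "max_const e < 2 ^ w" for e
    using val_less[OF assms(1,2) that] by (intro floorlog_leI) auto
  \<comment> \<open>Covers all binary operators at once; \<open>Cell\<close> is the case of an empty
    second operand, \<open>k = 0\<close> and \<open>d = 0\<close>.\<close>
  have binary: "1 + l + c + d \<le> (1 + j + k) * (1 + (1 + j + k) * w)"
    if "l \<le> (1 + j + k) * w" "c \<le> j * (1 + j * w)" "d \<le> k * (1 + k * w)" for l c d j k :: nat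
  proof -
    have "j * (1 + j * w) \<le> j * (1 + (1 + j + k) * w)" "k * (1 + k * w) \<le> k * (1 + (1 + j + k) * w)"
      by (intro mult_left_mono add_left_mono mult_right_mono; simp)+
    then show ?thesis using that by (simp add: algebra_simps)
  qed
  show ?thesis
    using assms(3)
  proof (induction e)
    case (Const c)
    then show ?case using log[of "Const c"] by simp
  next
    case (Cell a i)
    then show ?case
      using binary[of _ "expr_nodes i" 0 _ 0] log[of "Cell a i"] by simp
  next
    case (Add e f)
    then show ?case
      using binary[OF log[of "Add e f", simplified expr_nodes.simps]] by simp
  next
    case (Sub e f)
    then show ?case
      using binary[OF log[of "Sub e f", simplified expr_nodes.simps]] by simp
  next
    case (Mul e f)
    then show ?case
      using binary[OF log[of "Mul e f", simplified expr_nodes.simps]] by simp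
  next
    case (Div e f)
    then show ?case
      using binary[OF log[of "Div e f", simplified expr_nodes.simps]] by simp
  qed
qed

text \<open>The constants are large enough for all expressions in the two programs below.\<close>

definition small_expr :: "expr \<Rightarrow> bool" where
  "small_expr e \<longleftrightarrow> expr_nodes e \<le> 1000 \<and> max_const e < 2 ^ 9"

definition cost_bound :: "nat \<Rightarrow> nat" where
  "cost_bound w = 1000 * (1 + 1000 * w)"

lemma expr_cost_le_bound:
  assumes "cells_below (2 ^ w) m" "9 \<le> w" "small_expr e"
  shows "expr_cost e m \<le> cost_bound w"
proof -
  have "(2::nat) ^ 9 \<le> 2 ^ w" using assms(2) by (intro power_increasing) auto
  then have "expr_cost e m \<le> expr_nodes e * (1 + expr_nodes e * w)"
    using assms by (intro expr_cost_le_nodes) (auto simp: small_expr_def)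
  also have "\<dots> \<le> cost_bound w"
    unfolding cost_bound_def using assms(3)
    by (intro mult_mono add_mono) (auto simp: small_expr_def)
  finally show ?thesis .
qed

text \<open>\<open>exec\<close> determines the exact cost; upper bounds can be combined without
  computing it.\<close>

definition runs :: "com \<Rightarrow> config \<Rightarrow> nat \<Rightarrow> config \<Rightarrow> bool" where
  "runs c s T s' \<longleftrightarrow> (\<exists>t\<le>T. exec c s t s')"

lemma runs_Seq: "runs c s T s' \<Longrightarrow> runs d s' U s'' \<Longrightarrow> runs (Seq c d) s (T + U) s''"
  unfolding runs_def by (meson add_mono exec.Seq)

lemma runs_Store:
  assumes "cells_below (2 ^ w) m" "9 \<le> w" "small_expr e" "val e m = x"
  shows "runs (Store a (Const 0) e) (m, out) (1 + 2 * cost_bound w) (m(a := (m a)(0 := x)), out)"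
proof -
  have "small_expr (Const 0)" by (simp add: small_expr_def)
  note this[THEN expr_cost_le_bound[OF assms(1,2)]] expr_cost_le_bound[OF assms(1-3)]
  then show ?thesis
    unfolding runs_def using exec.Store[of a "Const 0" e m out] assms(4)
    by (intro exI[of _ "1 + expr_cost (Const 0) m + expr_cost e m"]) simp
qed

lemma runs_Write:
  assumes "cells_below (2 ^ w) m" "9 \<le> w" "small_expr e" "val e m = x"
  shows "runs (Write e) (m, out) (1 + cost_bound w) (m, out @ [x])"
  unfolding runs_def using exec.Write[of e m out] expr_cost_le_bound[OF assms(1-3)] assms(4)
  by (intro exI[of _ "1 + expr_cost e m"]) simp

text \<open>The loop invariant is an explicit family of states after \<open>k\<close> rounds. The
  extra round in \<open>K + 1\<close> pays for the final failing test.\<close>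

lemma runs_While:
  assumes mem: "\<And>k. k \<le> K \<Longrightarrow> cells_below (2 ^ w) (mem k)" "9 \<le> w" "small_expr e"
    and cont: "\<And>k. k < K \<Longrightarrow> val e (mem k) \<noteq> 0" "val e (mem K) = 0"
    and body: "\<And>k. k < K \<Longrightarrow> runs c (mem k, out k) T (mem (Suc k), out (Suc k))"
  shows "runs (While e c) (mem 0, out 0) ((K + 1) * (1 + cost_bound w + T)) (mem K, out K)"
proof -
  have cost: "expr_cost e (mem k) \<le> cost_bound w" if "k \<le> K" for k
    using that mem by (intro expr_cost_le_bound) auto
  have "runs (While e c) (mem k, out k) ((K - k + 1) * (1 + cost_bound w + T)) (mem K, out K)"
    if "k \<le> K" for k
    using that
  proof (induction rule: inc_induct)
    case base
    have "exec (While e c) (mem K, out K) (1 + expr_cost e (mem K)) (mem K, out K)"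
      by (rule exec.WhileFalse) (rule cont)
    then show ?case unfolding runs_def using cost[of K]
      by (intro exI[of _ "1 + expr_cost e (mem K)"]) simp
  next
    case (step k)
    from body[OF step(2)] obtain t where t: "t \<le> T" "exec c (mem k, out k) t (mem (Suc k), out (Suc k))"
      unfolding runs_def by blast
    from step.IH obtain u where u: "u \<le> (K - Suc k + 1) * (1 + cost_bound w + T)"
      "exec (While e c) (mem (Suc k), out (Suc k)) u (mem K, out K)"
      unfolding runs_def by blast
    have "exec (While e c) (mem k, out k) (1 + expr_cost e (mem k) + t + u) (mem K, out K)"
      using cont(1)[OF step(2)] t(2) u(2) by (rule exec.WhileTrue)
    moreover have "1 + expr_cost e (mem k) + t + u \<le>
        (1 + cost_bound w + T) + (K - Suc k + 1) * (1 + cost_bound w + T)"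
      using cost[of k] t(1) u(1) step(2) by linarith
    moreover have "\<dots> = (K - k + 1) * (1 + cost_bound w + T)"
      using step(2) by (simp add: Suc_diff_Suc[symmetric])
    ultimately show ?case unfolding runs_def by metis
  qed
  from this[of 0] show ?thesis by simp
qed

lemma outputs_within_if_runs:
  "runs c (initial_memory xs, []) T (m, ys) \<Longrightarrow> T \<le> U \<Longrightarrow> outputs_within c xs ys U"
  unfolding runs_def outputs_within_def by (meson order.trans)

section \<open>Input memory and graph encoding\<close>

lemma initial_memory_simps:
  "0 < a \<Longrightarrow> initial_memory xs a i = 0"
  "initial_memory xs 0 (Suc i) = (if i < length xs then xs ! i else 0)"
  by (simp_all add: initial_memory_def)

lemma length_le_input_size: "length xs \<le> input_size xs"
  by (induction xs) (auto simp: input_size_def)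

lemma cells_below_initial_memory:
  assumes "input_size xs \<le> w"
  shows "cells_below (2 ^ w) (initial_memory xs)"
proof -
  have "x < 2 ^ w" if "x \<in> set (length xs # xs)" for x
  \<comment> \<open>The length stored in cell 0 is not itself charged in \<open>input_size\<close>,
    but every entry is charged at least one, which bounds the length as well.\<close>
  proof (cases "x = length xs")
    case True
    then have "x \<le> w" using assms length_le_input_size[of xs] by simp
    then show ?thesis using less_exp[of w] by linarith
  next
    case False
    then have "x \<in> set xs" using that by simp
    then have "1 + floorlog 2 x \<le> input_size xs"
      unfolding input_size_def by (intro member_le_sum_list) auto
    then show ?thesis using assms by (intro floorlog_leD) auto
  qed
  then show ?thesis
    by (auto simp: cells_below_def initial_memory_def simp del: set_simps)
qed

lemma length_encode_graph: "length (encode_graph G) = 1 + card (pverts G) * card (pverts G)"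
  by (simp add: encode_graph_def Let_def)

lemma encode_graph_nth:
  assumes "u < card (pverts G)" "v < card (pverts G)"
  shows "encode_graph G ! Suc (u * card (pverts G) + v) = of_bool ((u, v) \<in> parcs G)"
proof -
  let ?n = "card (pverts G)"
  have "u * ?n + v < Suc u * ?n" using assms by simp
  also have "\<dots> \<le> ?n * ?n" using assms by (intro mult_right_mono) auto
  finally show ?thesis
    using assms by (simp add: encode_graph_def Let_def product_nth)
qed

text \<open>The program writes the matrix in a loop with a single counter, so entries are indexed by
  their row-major position.\<close>

lemma encode_graph_eq_map:
  "encode_graph G = (let n = card (pverts G) in
     n # map (\<lambda>k. of_bool ((k div n, k mod n) \<in> parcs G)) [0..<n * n])"
proof -
  have "map f (List.product [0..<n] [0..<n]) = map (\<lambda>k. f (k div n, k mod n)) [0..<n * n]"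
    for f :: "nat \<times> nat \<Rightarrow> nat" and n
  proof (rule nth_equalityI)
    fix k assume "k < length (map f (List.product [0..<n] [0..<n]))"
    then have k: "k < n * n" by simp
    then have "n > 0" by (cases n) auto
    then have "k div n < n" "k mod n < n" using k by (auto simp: less_mult_imp_div_less)
    then show "map f (List.product [0..<n] [0..<n]) ! k =
        map (\<lambda>k. f (k div n, k mod n)) [0..<n * n] ! k"
      using k by (simp add: product_nth)
  qed simp
  then show ?thesis by (simp add: encode_graph_def Let_def)
qed

section \<open>The two programs\<close>

text \<open>The number of added copies of \<open>K\<^sub>8\<close> is \<open>19 * reduction_scale a b n\<close>; the factor 19 makes the
  target size an exact affine function of it.\<close>

definition reduction_scale :: "nat \<Rightarrow> nat \<Rightarrow> nat \<Rightarrow> nat" where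
  "reduction_scale a b n = 2 * ((n + 1) * ((n + 1) * (b div a + 1)))"

text \<open>The vertex count sits in cell 3 of the input for the first program and in cell 5 for the second.\<close>

definition scale_expr :: "nat \<Rightarrow> expr" where
  "scale_expr p = (let n = Add (Cell 0 (Const p)) (Const 1) in
     Mul (Const 2) (Mul n (Mul n
       (Add (Div (Cell 0 (Const 2)) (Cell 0 (Const 1))) (Const 1)))))"

text \<open>Subtraction truncates at 0, so subtracting from 1 tests for zero. Comparisons evaluate
  to 0 or 1, and conjunction becomes multiplication.\<close>

definition lt_expr :: "expr \<Rightarrow> expr \<Rightarrow> expr" where
  "lt_expr x y = Sub (Const 1) (Sub (Const 1) (Sub y x))"

definition ge_expr :: "expr \<Rightarrow> expr \<Rightarrow> expr" where
  "ge_expr x y = Sub (Const 1) (Sub y x)"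

definition eq_expr :: "expr \<Rightarrow> expr \<Rightarrow> expr" where
  "eq_expr x y = Sub (Const 1) (Add (Sub x y) (Sub y x))"

lemma val_comparison:
  "val (lt_expr x y) m = of_bool (val x m < val y m)"
  "val (ge_expr x y) m = of_bool (val y m \<le> val x m)"
  "val (eq_expr x y) m = of_bool (val x m = val y m)"
  by (auto simp: lt_expr_def ge_expr_def eq_expr_def)

abbreviation (input) var :: "nat \<Rightarrow> expr" where
  "var a \<equiv> Cell a (Const 0)"

text \<open>Variable 1 holds the vertex count of the new graph, variable 2 a position in its matrix.
  The input matrix starts at cell 4, after the length, \<open>a\<close>, \<open>b\<close> and the
  vertex count. For entries outside it, the cell read is multiplied by 0.\<close>

definition arc_expr :: expr where
  "arc_expr = (let n = Cell 0 (Const 3); u = Div (var 2) (var 1);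
       v = Sub (var 2) (Mul (Div (var 2) (var 1)) (var 1)) in
     Add (Mul (lt_expr u n) (Mul (lt_expr v n) (Cell 0 (Add (Const 4) (Add (Mul u n) v)))))
       (Mul (ge_expr u n) (Mul (ge_expr v n)
         (Mul (eq_expr (Div (Sub u n) (Const 8)) (Div (Sub v n) (Const 8)))
           (Sub (Const 1) (eq_expr u v))))))"

text \<open>The factor 152 is \<open>8 * 19\<close>, the number of vertices in 19 copies of
  K_8.\<close>

definition construct_com :: com where
  "construct_com =
     Seq (Store 1 (Const 0) (Add (Cell 0 (Const 3)) (Mul (Const 152) (scale_expr 3))))
       (Seq (Write (var 1))
         (While (Sub (Mul (var 1) (var 1)) (var 2))
           (Seq (Write arc_expr) (Store 2 (Const 0) (Add (var 2) (Const 1))))))"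

text \<open>Variable 1 holds the scale \<open>s\<close>, variable 2 a counter \<open>k\<close>, and
  variable 3 the number \<open>8 ^ k * (r choose k)\<close> for \<open>r = 19 * s\<close>, updated
  by the ratio of consecutive terms. Approximations are fractions, so dividing by the last value
  means multiplying the denominator.\<close>

definition recover_com :: com where
  "recover_com =
     Seq (Store 1 (Const 0) (scale_expr 5))
       (Seq (Store 3 (Const 0) (Const 1))
         (Seq (While (Sub (Add (Mul (Const 16) (var 1)) (Div (Mul (Const 2) (Cell 0 (Const 5))) (Const 19)))
               (var 2))
             (Seq (Store 3 (Const 0) (Div (Mul (Mul (var 3) (Const 8)) (Sub (Mul (Const 19) (var 1)) (var 2)))
                 (Add (var 2) (Const 1))))
               (Store 2 (Const 0) (Add (var 2) (Const 1)))))
           (Seq (Write (Cell 0 (Const 3))) (Write (Mul (Cell 0 (Const 4)) (var 3))))))"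

section \<open>Correctness and running time of the two programs\<close>

lemmas small_expr_simps = small_expr_def Let_def scale_expr_def lt_expr_def ge_expr_def eq_expr_def

lemma small_arc_expr: "small_expr arc_expr"
  by (simp add: small_expr_simps arc_expr_def)

text \<open>The cases are the sides of \<open>n\<close> on which the two coordinates lie. In the
  mixed cases there is no arc, since \<open>wf\<close> keeps the arcs of \<open>G\<close> below
  \<open>n\<close> and the cliques lie above.\<close>

lemma val_arc_expr:
  assumes mem: "m 1 0 = M" "m 2 0 = k" "m 0 3 = n" and k: "k < M * M" and G: "card (pverts G) = n"
    and arcs: "\<And>u v. u < n \<Longrightarrow> v < n \<Longrightarrow> m 0 (4 + (u * n + v)) = of_bool ((u, v) \<in> parcs G)"
    and wf: "parcs G \<subseteq> {..<n} \<times> {..<n}" and M: "M = n + 8 * r"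
  shows "val arc_expr m = of_bool ((k div M, k mod M) \<in> parcs (add_cliques 8 r G))"
proof -
  let ?u = "k div M" and ?v = "k mod M"
  have "M > 0" using k by (cases M) auto
  then have less: "?u < M" "?v < M" using k by (auto simp: less_mult_imp_div_less)
  have v: "k - k div M * M = ?v" by (simp add: minus_div_mult_eq_mod)
  have "val arc_expr m =
    of_bool (?u < n) * (of_bool (?v < n) * m 0 (4 + (?u * n + ?v))) +
    of_bool (n \<le> ?u) * (of_bool (n \<le> ?v) *
      (of_bool ((?u - n) div 8 = (?v - n) div 8) * (1 - of_bool (?u = ?v))))"
    unfolding arc_expr_def Let_def val.simps val_comparison mem v ..
  also have "\<dots> = of_bool ((?u, ?v) \<in> parcs (add_cliques 8 r G))"
    using arcs[of ?u ?v] wf less unfolding parcs_add_cliques[of 8, simplified] Let_def G M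
    by (cases "?u < n"; cases "?v < n") auto
  finally show ?thesis .
qed

text \<open>The factor \<open>3 + 5 * cost_bound w\<close> bounds one round of the recovery loop,
  and also of the cheaper construction loop. The 4 additional rounds cover the final test and the
  commands outside the loop.\<close>

definition time_bound :: "nat \<Rightarrow> nat \<Rightarrow> nat" where
  "time_bound L w = (L + 4) * (3 + 5 * cost_bound w)"

lemma outputs_within_construct:
  fixes a b :: nat and G :: "nat pair_pre_digraph"
  defines "n \<equiv> card (pverts G)" and "s \<equiv> reduction_scale a b (card (pverts G))"
  defines "M \<equiv> n + 8 * (19 * s)" and "xs \<equiv> [a, b] @ encode_graph G"
  assumes G: "regular_graph 7 G" "pverts G = {..<card (pverts G)}"
    and w: "input_size xs \<le> w" "9 \<le> w" "M * M \<le> w"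
  shows "outputs_within construct_com xs (encode_graph (add_cliques 8 (19 * s) G))
    (time_bound (M * M) w)"
proof -
  let ?K = "cost_bound w"
  let ?G = "add_cliques 8 (19 * s) G"
  define m0 where "m0 = initial_memory xs"
  define m1 where "m1 = m0(1 := (m0 1)(0 := M))"
  define mem where "mem k = m1(2 := (m1 2)(0 := k))" for k
  define bit :: "nat \<Rightarrow> nat" where "bit k = of_bool ((k div M, k mod M) \<in> parcs ?G)" for k
  define out where "out k = M # map bit [0..<k]" for k
  have xs: "xs = a # b # encode_graph G" by (simp add: xs_def)
  have hd: "encode_graph G ! 0 = n" "encode_graph G \<noteq> []"
    by (simp_all add: encode_graph_def Let_def n_def)
  have m0: "m0 1 0 = 0" "m0 2 i = 0" "m0 0 (Suc 0) = a" "m0 0 2 = b" "m0 0 3 = n" for i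
    using hd by (simp_all add: m0_def initial_memory_simps xs numeral_eq_Suc)
  have arcs: "m0 0 (4 + (u * n + v)) = of_bool ((u, v) \<in> parcs G)" if "u < n" "v < n" for u v
  proof -
    have "u * n + v < Suc u * n" using that by simp
    also have "\<dots> \<le> n * n" using that by (intro mult_right_mono) auto
    finally have "u * n + v < n * n" .
    then show ?thesis
      using encode_graph_nth[of u G v] that length_encode_graph[of G]
      by (simp add: m0_def initial_memory_simps xs numeral_eq_Suc n_def)
  qed
  \<comment> \<open>Bounding a value by \<open>w\<close> itself is wasteful but affordable, because
    the counters are polynomially bounded.\<close>
  have pow: "x < 2 ^ w" if "x \<le> w" for x :: nat
    using that less_exp[of w] by linarith
  have M_le: "M \<le> w" using w(3) by (cases M) auto
  have b0: "cells_below (2 ^ w) m0" unfolding m0_def by (rule cells_below_initial_memory) fact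
  then have b1: "cells_below (2 ^ w) m1"
    unfolding m1_def by (intro cells_below_upd pow M_le)
  then have bmem: "cells_below (2 ^ w) (mem k)" if "k \<le> M * M" for k
    unfolding mem_def using that w(3) by (intro cells_below_upd pow) auto
  \<comment> \<open>The counter needs no initialisation, as arrays other than 0 start out as
    0.\<close>
  have mem0: "mem 0 = m1" by (auto simp: mem_def m1_def m0 fun_eq_iff)
  have mem_simps: "mem k (Suc 0) 0 = M" "mem k 2 0 = k" "mem k 0 = m0 0" for k
    by (simp_all add: mem_def m1_def)
  have "runs (Store 1 (Const 0) (Add (Cell 0 (Const 3)) (Mul (Const 152) (scale_expr 3)))) (m0, [])
      (1 + 2 * ?K) (m1, [])"
    unfolding m1_def
    by (rule runs_Store[OF b0 w(2)])
      (simp_all add: small_expr_simps m0 M_def s_def reduction_scale_def n_def[symmetric])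
  moreover have "runs (Write (var 1)) (m1, []) (1 + ?K) (mem 0, out 0)"
    unfolding mem0 using runs_Write[OF b1 w(2), of "var 1" M "[]"]
    by (simp add: small_expr_simps m1_def out_def)
  moreover have "runs (While (Sub (Mul (var 1) (var 1)) (var 2))
           (Seq (Write arc_expr) (Store 2 (Const 0) (Add (var 2) (Const 1)))))
      (mem 0, out 0) ((M * M + 1) * (1 + ?K + ((1 + ?K) + (1 + 2 * ?K)))) (mem (M * M), out (M * M))"
  proof (rule runs_While[OF bmem w(2)])
    fix k assume k: "k < M * M"
    have "val arc_expr (mem k) = bit k"
      unfolding bit_def
    proof (rule val_arc_expr)
      show "parcs G \<subseteq> {..<n} \<times> {..<n}"
        using regular_graph_arcsD[OF G(1)] G(2) unfolding n_def by auto
    qed (use k arcs m0 in \<open>auto simp: mem_simps n_def M_def\<close>)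
    then have "runs (Write arc_expr) (mem k, out k) (1 + ?K) (mem k, out k @ [bit k])"
      using k by (intro runs_Write[OF bmem w(2)] small_arc_expr) auto
    moreover have "runs (Store 2 (Const 0) (Add (var 2) (Const 1))) (mem k, out k @ [bit k])
        (1 + 2 * ?K) ((mem k)(2 := (mem k 2)(0 := Suc k)), out k @ [bit k])"
      using k by (intro runs_Store[OF bmem w(2)]) (auto simp: small_expr_simps mem_simps)
    moreover have "(mem k)(2 := (mem k 2)(0 := Suc k)) = mem (Suc k)" by (simp add: mem_def)
    moreover have "out k @ [bit k] = out (Suc k)" by (simp add: out_def)
    ultimately show "runs (Seq (Write arc_expr) (Store 2 (Const 0) (Add (var 2) (Const 1))))
        (mem k, out k) ((1 + ?K) + (1 + 2 * ?K)) (mem (Suc k), out (Suc k))"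
      by (metis runs_Seq)
  qed (auto simp: small_expr_simps mem_simps)
  ultimately have "runs construct_com (m0, []) ((1 + 2 * ?K) + ((1 + ?K) +
      (M * M + 1) * (1 + ?K + ((1 + ?K) + (1 + 2 * ?K))))) (mem (M * M), out (M * M))"
    unfolding construct_com_def by (intro runs_Seq)
  moreover have "out (M * M) = encode_graph ?G"
  proof -
    have "card (pverts ?G) = M"
      by (simp add: pverts_add_cliques[OF G(2)] M_def n_def)
    then show ?thesis
      unfolding encode_graph_eq_map[of ?G] Let_def by (simp add: out_def bit_def)
  qed
  ultimately show ?thesis
    unfolding m0_def by (intro outputs_within_if_runs) (auto simp: time_bound_def algebra_simps)
qed

text \<open>The stored number \<open>8 ^ k * (r choose k)\<close> is at most \<open>16 ^ r\<close>,
  so it has length linear in \<open>r\<close>; this is the source of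
  \<open>4 * r < w\<close>.\<close>

lemma outputs_within_recover:
  fixes a b p q :: nat and G :: "nat pair_pre_digraph"
  defines "n \<equiv> card (pverts G)" and "s \<equiv> reduction_scale a b (card (pverts G))"
  defines "r \<equiv> 19 * s" and "t \<equiv> 16 * s + 2 * n div 19" and "xs \<equiv> [a, b, p, q] @ encode_graph G"
  assumes w: "input_size xs \<le> w" "9 \<le> w" "4 * r < w" "t \<le> r"
  shows "outputs_within recover_com xs [p, q * (8 ^ t * (r choose t))] (time_bound t w)"
proof -
  let ?K = "cost_bound w"
  define m0 where "m0 = initial_memory xs"
  define m1 where "m1 = m0(1 := (m0 1)(0 := s))"
  define c where "c k = 8 ^ k * (r choose k)" for k
  define m2 where "m2 k = m1(3 := (m1 3)(0 := c k))" for k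
  define mem where "mem k = (m2 k)(2 := (m2 k 2)(0 := k))" for k
  have hd: "encode_graph G ! 0 = n" "encode_graph G \<noteq> []"
    by (simp_all add: encode_graph_def Let_def n_def)
  have xs: "xs = a # b # p # q # encode_graph G" by (simp add: xs_def)
  have m0: "m0 1 i = 0" "m0 2 i = 0" "m0 3 i = 0"
    "m0 0 (Suc 0) = a" "m0 0 2 = b" "m0 0 3 = p" "m0 0 4 = q" "m0 0 5 = n" for i
    using hd by (simp_all add: m0_def initial_memory_simps xs numeral_eq_Suc)
  have pow: "x < 2 ^ w" if "x \<le> w" for x :: nat
    using that less_exp[of w] by linarith
  have s_le: "s \<le> w" and t_le: "t \<le> w" using w(3,4) by (auto simp: r_def)
  have c_less: "c k < 2 ^ w" if "k \<le> t" for k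
  proof -
    have "c k \<le> 8 ^ r * 2 ^ r"
      unfolding c_def using that w(4)
      by (intro mult_mono power_increasing binomial_le_pow2) auto
    also have "\<dots> = (2 ^ 3 * 2) ^ r" by (simp add: power_mult_distrib[symmetric])
    also have "\<dots> = 2 ^ (4 * r)" by (simp add: power_mult)
    also have "\<dots> < (2::nat) ^ w" using w(3) by (intro power_strict_increasing) auto
    finally show ?thesis .
  qed
  have b0: "cells_below (2 ^ w) m0" unfolding m0_def by (rule cells_below_initial_memory) fact
  then have b1: "cells_below (2 ^ w) m1"
    unfolding m1_def by (intro cells_below_upd pow s_le)
  then have b2: "cells_below (2 ^ w) (m2 k)" if "k \<le> t" for k
    unfolding m2_def using that by (intro cells_below_upd c_less) auto
  then have bmem: "cells_below (2 ^ w) (mem k)" if "k \<le> t" for k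
    unfolding mem_def using that t_le by (intro cells_below_upd pow) auto
  have mem0: "mem 0 = m2 0" by (auto simp: mem_def m2_def m1_def m0 fun_eq_iff)
  have mem_simps: "mem k (Suc 0) 0 = s" "mem k 2 0 = k" "mem k 3 0 = c k" "mem k 0 = m0 0" for k
    by (simp_all add: mem_def m2_def m1_def)
  \<comment> \<open>The division is exact because
    \<open>(k + 1) * (r choose (k + 1)) = (r - k) * (r choose k)\<close>.\<close>
  have c_Suc: "c k * 8 * (r - k) div Suc k = c (Suc k)" for k
  proof -
    have "c k * 8 * (r - k) = 8 ^ Suc k * ((r - k) * (r choose k))" by (simp add: c_def)
    also have "(r - k) * (r choose k) = Suc k * (r choose Suc k)"
      by (simp only: binomial_absorb_comp binomial_absorption)
    also have "8 ^ Suc k * (Suc k * (r choose Suc k)) = c (Suc k) * Suc k"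
      by (simp add: c_def algebra_simps)
    finally show ?thesis by (simp only: nonzero_mult_div_cancel_right nat.distinct simp_thms)
  qed
  have "runs (Store 1 (Const 0) (scale_expr 5)) (m0, []) (1 + 2 * ?K) (m1, [])"
    unfolding m1_def
    by (rule runs_Store[OF b0 w(2)])
      (simp_all add: small_expr_simps m0 s_def reduction_scale_def n_def[symmetric])
  moreover have "runs (Store 3 (Const 0) (Const 1)) (m1, []) (1 + 2 * ?K) (mem 0, [])"
    unfolding mem0 m2_def
    by (rule runs_Store[OF b1 w(2)]) (simp_all add: small_expr_simps c_def)
  moreover have "runs (While (Sub (Add (Mul (Const 16) (var 1))
          (Div (Mul (Const 2) (Cell 0 (Const 5))) (Const 19))) (var 2))
        (Seq (Store 3 (Const 0) (Div (Mul (Mul (var 3) (Const 8)) (Sub (Mul (Const 19) (var 1)) (var 2)))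
            (Add (var 2) (Const 1))))
          (Store 2 (Const 0) (Add (var 2) (Const 1)))))
      (mem 0, []) ((t + 1) * (1 + ?K + ((1 + 2 * ?K) + (1 + 2 * ?K)))) (mem t, [])"
  proof (rule runs_While[where K = t and out = "\<lambda>_. []", OF bmem w(2)])
    fix k assume k: "k < t"
    define m' where "m' = (mem k)(3 := (mem k 3)(0 := c (Suc k)))"
    have b': "cells_below (2 ^ w) m'"
      unfolding m'_def using k by (intro cells_below_upd bmem c_less) auto
    have "runs (Store 3 (Const 0) (Div (Mul (Mul (var 3) (Const 8)) (Sub (Mul (Const 19) (var 1)) (var 2)))
            (Add (var 2) (Const 1)))) (mem k, []) (1 + 2 * ?K) (m', [])"
      unfolding m'_def using k c_Suc[of k]
      by (intro runs_Store[OF bmem w(2)]) (auto simp: small_expr_simps mem_simps r_def)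
    moreover have "runs (Store 2 (Const 0) (Add (var 2) (Const 1))) (m', [])
        (1 + 2 * ?K) (m'(2 := (m' 2)(0 := Suc k)), [])"
      by (rule runs_Store[OF b' w(2)]) (simp_all add: small_expr_simps mem_simps m'_def)
    moreover have "m'(2 := (m' 2)(0 := Suc k)) = mem (Suc k)"
      by (auto simp: mem_def m2_def m'_def fun_eq_iff)
    ultimately show "runs (Seq (Store 3 (Const 0) (Div (Mul (Mul (var 3) (Const 8))
              (Sub (Mul (Const 19) (var 1)) (var 2))) (Add (var 2) (Const 1))))
          (Store 2 (Const 0) (Add (var 2) (Const 1))))
        (mem k, []) ((1 + 2 * ?K) + (1 + 2 * ?K)) (mem (Suc k), [])"
      by (metis runs_Seq)
  qed (auto simp: small_expr_simps mem_simps m0 t_def)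
  moreover have "runs (Write (Cell 0 (Const 3))) (mem t, []) (1 + ?K) (mem t, [p])"
    using runs_Write[OF bmem w(2), of t "Cell 0 (Const 3)" p "[]"]
    by (simp add: small_expr_simps mem_simps m0)
  moreover have "runs (Write (Mul (Cell 0 (Const 4)) (var 3))) (mem t, [p]) (1 + ?K)
      (mem t, [p, q * c t])"
    using runs_Write[OF bmem w(2), of t "Mul (Cell 0 (Const 4)) (var 3)" "q * c t" "[p]"]
    by (simp add: small_expr_simps mem_simps m0)
  ultimately have "runs recover_com (m0, []) ((1 + 2 * ?K) + ((1 + 2 * ?K) +
      ((t + 1) * (1 + ?K + ((1 + 2 * ?K) + (1 + 2 * ?K))) + ((1 + ?K) + (1 + ?K)))))
      (mem t, [p, q * c t])"
    unfolding recover_com_def by (intro runs_Seq)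
  then show ?thesis
    unfolding m0_def c_def
    by (rule outputs_within_if_runs) (auto simp: time_bound_def algebra_simps)
qed

section \<open>The analytic estimate\<close>

lemma mult_approx_mult:
  "mult_approx \<delta> x y \<Longrightarrow> 0 \<le> c \<Longrightarrow> mult_approx \<delta> (c * x) (c * y)"
  by (auto simp: mult_approx_def mult.left_commute[of _ c] intro: mult_left_mono)

lemma mult_approx_sum:
  "(\<And>i. i \<in> A \<Longrightarrow> mult_approx \<delta> (f i) (g i)) \<Longrightarrow> mult_approx \<delta> (sum f A) (sum g A)"
  by (auto simp: mult_approx_def sum_distrib_left intro: sum_mono)

lemma mult_approx_trans:
  assumes "mult_approx \<delta> x y" "mult_approx \<gamma> y z"
  shows "mult_approx (\<delta> + \<gamma>) x z"
proof -
  have "exp (- (\<delta> + \<gamma>)) * z = exp (- \<delta>) * (exp (- \<gamma>) * z)" by (simp add: exp_add[symmetric])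
  also have "\<dots> \<le> exp (- \<delta>) * y"
    using assms(2) by (intro mult_left_mono) (auto simp: mult_approx_def)
  also have "\<dots> \<le> x" using assms(1) by (simp add: mult_approx_def)
  finally have 1: "exp (- (\<delta> + \<gamma>)) * z \<le> x" .
  have "x \<le> exp \<delta> * y" using assms(1) by (simp add: mult_approx_def)
  also have "\<dots> \<le> exp \<delta> * (exp \<gamma> * z)"
    using assms(2) by (intro mult_left_mono) (auto simp: mult_approx_def)
  also have "\<dots> = exp (\<delta> + \<gamma>) * z" by (simp add: exp_add)
  finally show ?thesis using 1 by (simp add: mult_approx_def)
qed

lemma mult_approx_mono:
  assumes "mult_approx \<delta> x y" "\<delta> \<le> \<gamma>" "0 \<le> y"
  shows "mult_approx \<gamma> x y"
proof -
  have "exp (- \<gamma>) * y \<le> exp (- \<delta>) * y" "exp \<delta> * y \<le> exp \<gamma> * y"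
    using assms by (auto intro!: mult_right_mono)
  then show ?thesis using assms(1) by (auto simp: mult_approx_def)
qed

text \<open>The coefficient of \<open>x ^ k\<close> in \<open>(1 + 8 * x) ^ r\<close>, the
  independence polynomial of \<open>r\<close> disjoint copies of K_8.\<close>

definition clique_count :: "nat \<Rightarrow> nat \<Rightarrow> real" where
  "clique_count r k = 8 ^ k * real (r choose k)"

text \<open>The ratio of consecutive coefficients, cross-multiplied. For \<open>k\<close> at least
  \<open>r\<close> both sides vanish, so truncated subtraction does no harm.\<close>

lemma clique_count_Suc:
  "real (Suc k) * clique_count r (Suc k) = 8 * real (r - k) * clique_count r k"
proof -
  have "real (Suc k * (r choose Suc k)) = real ((r - k) * (r choose k))"
    by (simp only: binomial_absorb_comp binomial_absorption)
  then have eq: "real (Suc k) * real (r choose Suc k) = real (r - k) * real (r choose k)"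
    by (simp only: of_nat_mult)
  have "real (Suc k) * clique_count r (Suc k) = 8 ^ Suc k * (real (Suc k) * real (r choose Suc k))"
    by (simp add: clique_count_def)
  then show ?thesis unfolding eq by (simp add: clique_count_def)
qed

lemma clique_count_Suc_mono:
  assumes "Suc k + 8 * k \<le> 8 * r"
  shows "clique_count r k \<le> clique_count r (Suc k)"
proof -
  have k: "real (Suc k) \<le> 8 * real (r - k)" using assms by simp
  have "real (Suc k) * clique_count r k \<le> 8 * real (r - k) * clique_count r k"
    using k by (intro mult_right_mono) (auto simp: clique_count_def)
  also have "\<dots> = real (Suc k) * clique_count r (Suc k)" by (rule clique_count_Suc[symmetric])
  finally show ?thesis by (simp del: of_nat_Suc)
qed

text \<open>The second hypothesis keeps \<open>l\<close> on the ascending side of the peak near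
  \<open>8 * r / 9\<close>, where the ratio of consecutive terms is at least 1.\<close>

lemma clique_count_mono:
  assumes "k \<le> l" "9 * l \<le> 8 * r"
  shows "clique_count r k \<le> clique_count r l"
  using assms
proof (induction l rule: dec_induct)
  case (step l)
  have "clique_count r k \<le> clique_count r l" using step by simp
  also have "\<dots> \<le> clique_count r (Suc l)" using step by (intro clique_count_Suc_mono) auto
  finally show ?case .
qed simp

text \<open>Near the level \<open>k = 16 r / 19\<close> the ratio of consecutive terms is close to
  \<open>k / (8 (r - k)) = 2/3\<close>, the fugacity.\<close>

lemma clique_count_step:
  fixes s t j n :: nat and \<delta> :: real
  assumes "j \<le> n" "t \<le> n" "n \<le> s" "0 < j" "0 \<le> \<delta>" "19 * real n \<le> 32 * \<delta> * real s"
  shows "mult_approx \<delta> (clique_count (19 * s) (16 * s + t - j))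
    (2/3 * clique_count (19 * s) (16 * s + t - (j - 1)))"
proof -
  define k where "k = 16 * s + t - j"
  define A where "A = clique_count (19 * s) k"
  define C where "C = clique_count (19 * s) (Suc k)"
  have k: "16 * s + t - (j - 1) = Suc k" "k + j = 16 * s + t"
    using assms by (auto simp: k_def)
  have kr: "real k = 16 * real s + real t - real j" using k(2) by linarith
  have s: "0 < real s" using assms by linarith
  have "19 * s - k + t = 3 * s + j" using k assms by linarith
  then have rk: "real (19 * s - k) = 3 * real s - real t + real j" by linarith
  have AC: "(real k + 1) * C = 8 * (3 * real s - real t + real j) * A"
    using clique_count_Suc[of k "19 * s"] unfolding rk A_def C_def by (simp add: add.commute)
  have n: "real j \<le> real n" "real t \<le> real n" "real n \<le> real s" "1 \<le> real j" using assms by auto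
  define P where "P = real k + 1"
  define Q where "Q = 8 * (3 * real s - real t + real j)"
  have pos: "0 < P" "0 < Q" "0 \<le> A" "0 \<le> C"
    using n s by (auto simp: P_def Q_def A_def C_def clique_count_def)
  have PC: "P * C = Q * A" using AC by (simp add: P_def Q_def)
  have e: "1 + \<delta> \<le> exp \<delta>" by simp
  \<comment> \<open>The bounds \<open>2 * s\<close> and \<open>15 * s\<close> come from
    \<open>t\<close> and \<open>j\<close> being at most \<open>n\<close>, hence at most
    \<open>s\<close>. As \<open>3 * P - 2 * Q = 19 * (t - j) + 3\<close> has absolute value at most
    \<open>19 * n\<close>, the hypothesis on \<open>32 * \<delta> * s\<close> absorbs it into the
    factor \<open>1 + \<delta>\<close>.\<close>
  have "\<delta> * (2 * real s) \<le> \<delta> * (3 * real s - real t + real j)"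
    "\<delta> * (15 * real s) \<le> \<delta> * P"
    using n assms(5) by (auto intro!: mult_left_mono simp: P_def kr)
  then have lin: "3 * P \<le> 2 * Q * (1 + \<delta>)" "2 * Q \<le> 3 * P * (1 + \<delta>)"
    using n assms(5,6) s unfolding P_def Q_def kr by (simp_all add: algebra_simps)
  have "2 * Q * (1 + \<delta>) \<le> 2 * Q * exp \<delta>" "3 * P * (1 + \<delta>) \<le> 3 * P * exp \<delta>"
    using pos by (auto intro!: mult_left_mono)
  note PQ = lin(1)[THEN order.trans, OF this(1)] lin(2)[THEN order.trans, OF this(2)]
  have "Q * A = P * C" using PC by simp
  also have "\<dots> \<le> (2/3 * Q * exp \<delta>) * C" using PQ(1) pos by (intro mult_right_mono) auto
  finally have "Q * A \<le> Q * (exp \<delta> * (2/3 * C))" by (simp add: mult_ac)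
  then have upper: "A \<le> exp \<delta> * (2/3 * C)" using pos by simp
  have "P * (2/3 * C) = 2/3 * Q * A" using PC by simp
  also have "\<dots> \<le> (P * exp \<delta>) * A" using PQ(2) pos by (intro mult_right_mono) auto
  finally have "P * (2/3 * C) \<le> P * (exp \<delta> * A)" by (simp add: mult_ac)
  then have "2/3 * C \<le> exp \<delta> * A" using pos by simp
  then have "exp (- \<delta>) * (2/3 * C) \<le> A"
    by (simp add: exp_minus field_simps)
  then show ?thesis
    using upper unfolding k k_def[symmetric] A_def[symmetric] C_def[symmetric]
    by (simp add: mult_approx_def)
qed

text \<open>Each of the \<open>j\<close> downward steps contributes a factor 2/3 and an error
  \<open>\<delta>\<close>; the errors add up in the exponent.\<close>

lemma clique_count_shift:
  fixes s t j n :: nat and \<delta> :: real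
  assumes "j \<le> n" "t \<le> n" "n \<le> s" "0 \<le> \<delta>" "19 * real n \<le> 32 * \<delta> * real s"
  shows "mult_approx (real j * \<delta>) (clique_count (19 * s) (16 * s + t - j))
    ((2/3) ^ j * clique_count (19 * s) (16 * s + t))"
  using assms(1)
proof (induction j)
  case 0
  then show ?case by (simp add: mult_approx_def)
next
  case (Suc j)
  have "mult_approx \<delta> (clique_count (19 * s) (16 * s + t - Suc j))
      (2/3 * clique_count (19 * s) (16 * s + t - j))"
    using clique_count_step[of "Suc j" n t s \<delta>] Suc.prems assms by simp
  moreover have "mult_approx (real j * \<delta>) (2/3 * clique_count (19 * s) (16 * s + t - j))
      (2/3 * ((2/3) ^ j * clique_count (19 * s) (16 * s + t)))"
    using Suc by (intro mult_approx_mult) auto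
  ultimately have "mult_approx (\<delta> + real j * \<delta>) (clique_count (19 * s) (16 * s + t - Suc j))
      (2/3 * ((2/3) ^ j * clique_count (19 * s) (16 * s + t)))"
    by (rule mult_approx_trans)
  then show ?case by (simp add: algebra_simps)
qed

section \<open>Independent sets of the constructed graph\<close>

context
  fixes G :: "nat pair_pre_digraph" and n s t r :: nat
  assumes G: "regular_graph 7 G" "pverts G = {..<card (pverts G)}"
  defines "n \<equiv> card (pverts G)" and "t \<equiv> 2 * card (pverts G) div 19" and "r \<equiv> 19 * s"
begin

lemma target_size_add_cliques: "target_size (2/19) (add_cliques 8 r G) = 16 * s + t"
proof -
  have "card (pverts (add_cliques 8 r G)) = n + 8 * r"
    by (simp add: pverts_add_cliques[OF G(2)] n_def)
  \<comment> \<open>As a quotient of naturals the floor becomes \<open>div\<close>, and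
    \<open>16 * r = 19 * (16 * s)\<close> divides exactly.\<close>
  then have "2/19 * real (card (pverts (add_cliques 8 r G))) =
      real (2 * n + 16 * r) / real 19" by simp
  then have "target_size (2/19) (add_cliques 8 r G) = (2 * n + 16 * r) div 19"
    unfolding target_size_def by (simp only: floor_divide_of_nat_eq nat_int)
  then show ?thesis by (simp add: r_def t_def n_def)
qed

lemma num_indep_sets_add_cliques_real:
  "real (num_indep_sets (add_cliques 8 r G) k) =
    (\<Sum>j\<le>k. real (num_indep_sets G j) * clique_count r (k - j))"
  using num_indep_sets_add_cliques[OF G, of r k]
  by (simp add: clique_count_def mult_ac)

lemma indep_set_inc_add_cliques:
  assumes "n \<le> s"
  shows "indep_set_inc_instance 7 (2/19) (add_cliques 8 r G)"
proof -
  have "num_indep_sets (add_cliques 8 r G) k \<le> num_indep_sets (add_cliques 8 r G) (16 * s + t)"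
    if k: "k < 16 * s + t" for k
  proof -
    \<comment> \<open>With \<open>n \<le> s\<close> this puts the target below the peak:
      \<open>9 * (16 * s + t) \<le> 8 * (19 * s)\<close>.\<close>
    have t: "19 * t \<le> 2 * n" unfolding t_def n_def by simp
    have "real (num_indep_sets (add_cliques 8 r G) k) \<le>
        (\<Sum>j\<le>k. real (num_indep_sets G j) * clique_count r (16 * s + t - j))"
      unfolding num_indep_sets_add_cliques_real
      using k t assms by (intro sum_mono mult_left_mono clique_count_mono) (auto simp: r_def)
    also have "\<dots> \<le> (\<Sum>j\<le>16 * s + t. real (num_indep_sets G j) * clique_count r (16 * s + t - j))"
      using k by (intro sum_mono2) (auto simp: clique_count_def)
    also have "\<dots> = real (num_indep_sets (add_cliques 8 r G) (16 * s + t))"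
      by (rule num_indep_sets_add_cliques_real[symmetric])
    finally show ?thesis by simp
  qed
  then show ?thesis
    using regular_graph_add_cliques[OF G, of r]
    by (simp add: indep_set_inc_instance_def target_size_add_cliques)
qed

lemma num_indep_sets_target_approx:
  assumes "n \<le> s" "0 < \<epsilon>" "19 * real (n * (n + 1)) \<le> 16 * \<epsilon> * real s"
  shows "mult_approx (\<epsilon> / 2) (real (num_indep_sets (add_cliques 8 r G) (16 * s + t)))
    (clique_count r (16 * s + t) * hardcore_Z G (2/3))"
proof -
  \<comment> \<open>At most \<open>n\<close> steps of error \<open>\<delta>\<close> add up to at
    most \<open>\<epsilon> / 2\<close>; using \<open>n + 1\<close> avoids a zero denominator for the
    empty graph.\<close>
  define \<delta> where "\<delta> = \<epsilon> / (2 * real (n + 1))"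
  have fin: "finite (pverts G)" using G by (metis finite_lessThan)
  have t: "t \<le> n" by (simp add: t_def n_def)
  have \<delta>: "0 \<le> \<delta>" "19 * real n \<le> 32 * \<delta> * real s"
    using assms(2,3) by (simp_all add: \<delta>_def field_simps)
  have summand: "mult_approx (\<epsilon> / 2) (real (num_indep_sets G j) * clique_count r (16 * s + t - j))
      (real (num_indep_sets G j) * ((2/3) ^ j * clique_count r (16 * s + t)))" if "j \<le> n" for j
  proof (intro mult_approx_mult)
    have "real j * \<delta> \<le> real (n + 1) * \<delta>" using that \<delta>(1) by (intro mult_right_mono) auto
    also have "\<dots> = \<epsilon> / 2" by (simp add: \<delta>_def del: of_nat_add of_nat_Suc)
    finally show "mult_approx (\<epsilon> / 2) (clique_count r (16 * s + t - j))
        ((2/3) ^ j * clique_count r (16 * s + t))"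
      unfolding r_def
      by (intro mult_approx_mono[OF clique_count_shift[OF that t assms(1) \<delta>]])
        (auto simp: clique_count_def)
  qed simp
  \<comment> \<open>Summands with \<open>j > n\<close> vanish, and \<open>n \<le> s\<close> ensures
    that every \<open>j \<le> n\<close> occurs.\<close>
  have "real (num_indep_sets (add_cliques 8 r G) (16 * s + t)) =
      (\<Sum>j\<le>n. real (num_indep_sets G j) * clique_count r (16 * s + t - j))"
    unfolding num_indep_sets_add_cliques_real
    by (rule sum.mono_neutral_right)
      (use assms(1) num_indep_sets_eq_0[OF fin] in \<open>auto simp: n_def not_le\<close>)
  moreover have "clique_count r (16 * s + t) * hardcore_Z G (2/3) =
      (\<Sum>j\<le>n. real (num_indep_sets G j) * ((2/3) ^ j * clique_count r (16 * s + t)))"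
    unfolding hardcore_Z_eq_sum[OF fin] n_def by (simp add: sum_distrib_left mult_ac)
  ultimately show ?thesis using mult_approx_sum[of "{..n}", OF summand] by simp
qed

end

section \<open>The reduction\<close>

lemma of_nat_mult_div_eq: "real (p :: nat) / real (q * (8 ^ t * (r choose t))) =
    1 / clique_count r t * (real p / real q)"
  by (simp add: clique_count_def)

text \<open>The argument will bound both the vertex count and \<open>b div a\<close>;
  \<open>304 = 8 * 19 * 2\<close> includes the factor 2 of \<open>reduction_scale\<close>.\<close>

definition vertex_poly :: "nat poly" where
  "vertex_poly = [:0, 1:] + 304 * [:1, 1:] ^ 3"

text \<open>The summands cover the input size, the values of the loop counters and the constant 9
  required of \<open>w\<close>.\<close>

definition width_poly :: "nat poly" where
  "width_poly = [:0, 1:] + vertex_poly * vertex_poly + 10"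

definition time_poly :: "nat poly" where
  "time_poly = (vertex_poly * vertex_poly + 4) * (3 + 5000 * (1 + 1000 * width_poly))"

lemma poly_vertex_poly: "poly vertex_poly x = x + 304 * (x + 1) ^ 3"
  by (simp add: vertex_poly_def algebra_simps)

lemma poly_width_poly: "poly width_poly x = x + poly vertex_poly x * poly vertex_poly x + 10"
  by (simp add: width_poly_def)

lemma time_bound_le_time_poly:
  assumes "L \<le> poly vertex_poly x * poly vertex_poly x"
  shows "time_bound L (poly width_poly x) \<le> poly time_poly x"
proof -
  have "poly time_poly x = time_bound (poly vertex_poly x * poly vertex_poly x) (poly width_poly x)"
    by (simp add: time_poly_def time_bound_def cost_bound_def)
  then show ?thesis using assms by (simp add: time_bound_def)
qed

lemma vertex_count_le:
  assumes "n \<le> x" "b div a \<le> x"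
  shows "n + 8 * (19 * reduction_scale a b n) \<le> poly vertex_poly x"
proof -
  have "(n + 1) * ((n + 1) * (b div a + 1)) \<le> (x + 1) * ((x + 1) * (x + 1))"
    using assms by (intro mult_mono add_mono) auto
  then show ?thesis
    using assms(1) unfolding poly_vertex_poly reduction_scale_def power3_eq_cube mult.assoc by linarith
qed

text \<open>The binary number \<open>n\<close> alone contributes only its length; the bound comes
  from the matrix entries, each charged at least one.\<close>

lemma vertices_le_input_size: "card (pverts G) \<le> input_size (ys @ encode_graph G)"
proof -
  have "card (pverts G) \<le> card (pverts G) * card (pverts G)" by simp
  also have "\<dots> \<le> length (ys @ encode_graph G)" by (simp add: length_encode_graph)
  also have "\<dots> \<le> input_size (ys @ encode_graph G)" by (rule length_le_input_size)
  finally show ?thesis .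
qed

lemma reduction_correct:
  fixes \<epsilon> :: real and a b :: nat and G :: "nat pair_pre_digraph"
  defines "n \<equiv> card (pverts G)" and "G' \<equiv> add_cliques 8 (19 * reduction_scale a b (card (pverts G))) G"
  assumes \<epsilon>: "0 < \<epsilon>" "\<epsilon> = real a / real b"
    and G: "regular_graph 7 G" "pverts G = {..<card (pverts G)}"
  shows "indep_set_inc_instance 7 (2/19) G'" (is ?inc)
    and "pverts G' = {..<card (pverts G')}" (is ?verts)
    and "card (pverts G') \<le> poly vertex_poly (n + nat \<lceil>1 / \<epsilon>\<rceil>)" (is ?size)
    and "outputs_within construct_com ([a, b] @ encode_graph G) (encode_graph G')
      (poly time_poly (input_size ([a, b] @ encode_graph G) + nat \<lceil>1 / \<epsilon>\<rceil>))" (is ?construct)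
    and "0 < q \<Longrightarrow> mult_approx (\<epsilon> / 2) (real p / real q)
        (real (num_indep_sets G' (target_size (2/19) G'))) \<Longrightarrow>
      \<exists>p' q'. 0 < q' \<and>
        outputs_within recover_com ([a, b, p, q] @ encode_graph G) [p', q']
          (poly time_poly (input_size ([a, b, p, q] @ encode_graph G) + nat \<lceil>1 / \<epsilon>\<rceil>)) \<and>
        mult_approx \<epsilon> (real p' / real q') (hardcore_Z G (2/3))" (is "_ \<Longrightarrow> _ \<Longrightarrow> ?recover")
proof -
  let ?N = "nat \<lceil>1 / \<epsilon>\<rceil>"
  define s where "s = reduction_scale a b n"
  define r where "r = 19 * s"
  define t where "t = 16 * s + 2 * n div 19"
  define M where "M = n + 8 * (19 * s)"
  have G': "G' = add_cliques 8 r G" unfolding G'_def r_def s_def n_def ..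
  \<comment> \<open>Division by 0 yields 0, so a positive \<open>\<epsilon>\<close> excludes
    \<open>b = 0\<close> as well.\<close>
  have "0 < a" "0 < b" using \<epsilon> by (auto intro!: Nat.gr0I)
  then have inv: "1 / \<epsilon> = real b / real a" using \<epsilon> by simp
  have div: "b div a \<le> ?N"
  proof -
    have "real (b div a) \<le> 1 / \<epsilon>" unfolding inv by (rule of_nat_div_le_of_nat)
    then show ?thesis by linarith
  qed
  \<comment> \<open>\<open>b div a + 1\<close> is an upper bound for \<open>1 / \<epsilon>\<close>
    that the programs can compute in integers.\<close>
  have inv_le: "1 \<le> \<epsilon> * real (b div a + 1)"
  proof -
    have "b \<le> a * (b div a + 1)"
      using \<open>0 < a\<close> dividend_less_times_div[of a b] by simp
    then have "real b \<le> real a * real (b div a + 1)"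
      by (metis of_nat_mult of_nat_le_iff)
    then have "real b / real b \<le> real a * real (b div a + 1) / real b"
      by (rule divide_right_mono) simp
    then show ?thesis using \<epsilon>(2) \<open>0 < b\<close> by simp
  qed
  have ns: "n + 1 \<le> s"
  proof -
    have "1 * ((n + 1) * 1) \<le> s"
      unfolding s_def reduction_scale_def by (intro mult_mono) auto
    then show ?thesis by simp
  qed
  \<comment> \<open>By the choice of scale, \<open>\<epsilon> * s\<close> is at least
    \<open>2 * n * (n + 1)\<close>; the factor 2 compensates for 16 being less than 19.\<close>
  have fine: "19 * real (n * (n + 1)) \<le> 16 * \<epsilon> * real s"
  proof -
    have "real (n * (n + 1)) \<le> real ((n + 1) * (n + 1)) * 1" by (simp add: algebra_simps)
    also have "\<dots> \<le> real ((n + 1) * (n + 1)) * (\<epsilon> * real (b div a + 1))"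
      using inv_le by (intro mult_left_mono) auto
    also have "2 * \<dots> = \<epsilon> * real s"
      by (simp add: s_def reduction_scale_def algebra_simps)
    finally have "2 * real (n * (n + 1)) \<le> \<epsilon> * real s" by simp
    moreover have "0 \<le> real (n * (n + 1))" by simp
    ultimately show ?thesis by linarith
  qed
  \<comment> \<open>Makes \<open>r choose t\<close> positive, so that dividing by it is
    legitimate.\<close>
  have tr: "t \<le> r" unfolding t_def r_def using ns by linarith
  have verts: "pverts G' = {..<M}"
    unfolding G' M_def r_def n_def by (rule pverts_add_cliques[OF G(2)])
  show ?verts by (simp add: verts)
  show ?inc
    unfolding G' r_def using indep_set_inc_add_cliques[OF G] ns by (simp add: n_def)
  show ?size
    unfolding verts card_lessThan M_def s_def using div by (intro vertex_count_le) auto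
  have sq: "x * x \<le> y * y" if "x \<le> y" for x y :: nat using that by (intro mult_mono) auto
  show ?construct
  proof -
    let ?x = "input_size ([a, b] @ encode_graph G) + ?N"
    have "n \<le> ?x" unfolding n_def using vertices_le_input_size[of G "[a, b]"] by linarith
    then have M: "M \<le> poly vertex_poly ?x"
      unfolding M_def s_def using div by (intro vertex_count_le) auto
    have "outputs_within construct_com ([a, b] @ encode_graph G) (encode_graph G')
        (time_bound (M * M) (poly width_poly ?x))"
      using outputs_within_construct[OF G, of a b "poly width_poly ?x"] sq[OF M]
      unfolding G' r_def s_def M_def n_def poly_width_poly by simp
    moreover have "time_bound (M * M) (poly width_poly ?x) \<le> poly time_poly ?x"
      by (rule time_bound_le_time_poly) (rule sq[OF M])
    ultimately show ?thesis unfolding outputs_within_def by (meson order.trans)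
  qed
  have target: "target_size (2/19) G' = t"
    unfolding G' r_def using target_size_add_cliques[OF G] by (simp add: t_def n_def)
  show ?recover if q: "0 < q" and approx: "mult_approx (\<epsilon> / 2) (real p / real q)
        (real (num_indep_sets G' (target_size (2/19) G')))"
  proof (intro exI conjI)
    let ?x = "input_size ([a, b, p, q] @ encode_graph G) + ?N"
    have "n \<le> ?x" unfolding n_def using vertices_le_input_size[of G "[a, b, p, q]"] by linarith
    then have M: "M \<le> poly vertex_poly ?x"
      unfolding M_def s_def using div by (intro vertex_count_le) auto
    have "M \<le> M * M" by simp
    also note sq[OF M]
    finally have M2: "M \<le> poly vertex_poly ?x * poly vertex_poly ?x" .
    have "4 * r \<le> M" "t \<le> M" using tr by (auto simp: M_def r_def)
    then have "4 * r < poly width_poly ?x" "t \<le> poly vertex_poly ?x * poly vertex_poly ?x"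
      using M2 by (auto simp: poly_width_poly)
    moreover from this have "outputs_within recover_com ([a, b, p, q] @ encode_graph G)
        [p, q * (8 ^ t * (r choose t))] (time_bound t (poly width_poly ?x))"
      using outputs_within_recover[of a b p q G "poly width_poly ?x"] tr
      unfolding t_def r_def s_def n_def by (simp add: poly_width_poly)
    ultimately show "outputs_within recover_com ([a, b, p, q] @ encode_graph G)
        [p, q * (8 ^ t * (r choose t))] (poly time_poly ?x)"
      using time_bound_le_time_poly[of t ?x] unfolding outputs_within_def by (meson order.trans)
    have pos: "0 < clique_count r t" using tr by (simp add: clique_count_def zero_less_binomial)
    show "0 < q * (8 ^ t * (r choose t))" using q tr by (simp add: zero_less_binomial)
    have "mult_approx (\<epsilon> / 2) (real (num_indep_sets G' t)) (clique_count r t * hardcore_Z G (2/3))"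
      unfolding G' r_def t_def
      using num_indep_sets_target_approx[OF G, of s \<epsilon>] ns \<epsilon>(1) fine by (simp add: n_def)
    \<comment> \<open>Half of the error comes from the given approximation, half from replacing the
      count by the multiple of the partition function.\<close>
    with approx have "mult_approx (\<epsilon> / 2 + \<epsilon> / 2) (real p / real q)
        (clique_count r t * hardcore_Z G (2/3))"
      unfolding target by (rule mult_approx_trans)
    then have "mult_approx \<epsilon> (1 / clique_count r t * (real p / real q))
        (1 / clique_count r t * (clique_count r t * hardcore_Z G (2/3)))"
      using pos by (intro mult_approx_mult) auto
    then show "mult_approx \<epsilon> (real p / real (q * (8 ^ t * (r choose t)))) (hardcore_Z G (2/3))"
      unfolding of_nat_mult_div_eq using pos by simp
  qed
qed

theorem theoremA2:
  shows "\<exists>(construct :: com) (recover :: com) (time :: nat poly) (size_bound :: nat poly).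
    \<forall>(\<epsilon> :: real) (a :: nat) (b :: nat) (G :: nat pair_pre_digraph).
      0 < \<epsilon> \<longrightarrow> \<epsilon> \<le> 1 \<longrightarrow> \<epsilon> = real a / real b \<longrightarrow>
      regular_graph 7 G \<longrightarrow> pverts G = {..<card (pverts G)} \<longrightarrow>
      (\<exists>G' :: nat pair_pre_digraph.
         indep_set_inc_instance 7 (2/19) G' \<and>
         pverts G' = {..<card (pverts G')} \<and>
         card (pverts G') \<le> poly size_bound (card (pverts G) + nat \<lceil>1 / \<epsilon>\<rceil>) \<and>
         (let xs = [a, b] @ encode_graph G in
            outputs_within construct xs (encode_graph G')
              (poly time (input_size xs + nat \<lceil>1 / \<epsilon>\<rceil>))) \<and>
         (\<forall>(p :: nat) (q :: nat). q > 0 \<longrightarrow>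
            mult_approx (\<epsilon> / 2) (real p / real q)
              (real (num_indep_sets G' (target_size (2/19) G'))) \<longrightarrow>
            (\<exists>(p' :: nat) (q' :: nat). q' > 0 \<and>
               (let xs = [a, b, p, q] @ encode_graph G in
                  outputs_within recover xs [p', q']
                    (poly time (input_size xs + nat \<lceil>1 / \<epsilon>\<rceil>))) \<and>
               mult_approx \<epsilon> (real p' / real q') (hardcore_Z G (2/3)))))"
proof (rule exI[of _ construct_com], rule exI[of _ recover_com], rule exI[of _ time_poly],
    rule exI[of _ vertex_poly], intro allI impI)
  fix \<epsilon> :: real and a b :: nat and G :: "nat pair_pre_digraph"
  assume "0 < \<epsilon>" "\<epsilon> \<le> 1" "\<epsilon> = real a / real b" "regular_graph 7 G" "pverts G = {..<card (pverts G)}"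
  note correct = reduction_correct[OF this(1,3-5)]
  show "\<exists>G' :: nat pair_pre_digraph.
         indep_set_inc_instance 7 (2/19) G' \<and>
         pverts G' = {..<card (pverts G')} \<and>
         card (pverts G') \<le> poly vertex_poly (card (pverts G) + nat \<lceil>1 / \<epsilon>\<rceil>) \<and>
         (let xs = [a, b] @ encode_graph G in
            outputs_within construct_com xs (encode_graph G')
              (poly time_poly (input_size xs + nat \<lceil>1 / \<epsilon>\<rceil>))) \<and>
         (\<forall>(p :: nat) (q :: nat). q > 0 \<longrightarrow>
            mult_approx (\<epsilon> / 2) (real p / real q)
              (real (num_indep_sets G' (target_size (2/19) G'))) \<longrightarrow>
            (\<exists>(p' :: nat) (q' :: nat). q' > 0 \<and>
               (let xs = [a, b, p, q] @ encode_graph G in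
                  outputs_within recover_com xs [p', q']
                    (poly time_poly (input_size xs + nat \<lceil>1 / \<epsilon>\<rceil>))) \<and>
               mult_approx \<epsilon> (real p' / real q') (hardcore_Z G (2/3))))"
    unfolding Let_def using correct by blast
qed

end
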